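(* Let $H$ be a finite group, $X$ and $Y$ topological spaces, and let $(h,x)\mapsto hx$ be a free left action of $H$ on $X$. Let $f\colon X\to Y$ be a map whose restriction to every $H$-orbit of $X$ is injective, and let $F_f\colon X\to F_H(Y)$ be the map given by $F_f(x)(h)=f(hx)$. Then $F_f$ is equivariant with respect to the monomorphism $\iota\colon H\to S_H$, the free left action of $H$ on $X$ and the free left action of $S_H$ on $F_H(Y)$; i.e., $F_f(hx)=\iota(h)\star F_f(x)$ for all $h\in H$ and $x\in X$.
   Context: $F_H(Y)$ is the space of injective maps $H\to Y$ with the compact-open topology ($H$ discrete). $S_H$ is the group of bijections of the set $H$ with product $\alpha_1\alpha_2:=\alpha_2\circ\alpha_1$; it acts on the left on $F_H(Y)$ by $\alpha\star\beta=\beta\circ\alpha$. The monomorphism $\iota\colon H\to S_H$ is given by $\iota(h)(h_1)=h_1h$ for $h,h_1\in H$. "Map" means continuous map. *)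

theory Defs
  imports "HOL-Analysis.Analysis" "HOL-Algebra.Group_Action"
begin

text \<open>The space of continuous maps from \<open>X\<close> to \<open>Y\<close> with the compact-open topology.
  A map is represented by its extensional representative on \<open>topspace X\<close>. The given sets
  form a subbasis; they cover the set of all maps, as \<open>K\<close> may be empty.\<close>

definition compact_open_topology :: "'a topology \<Rightarrow> 'b topology \<Rightarrow> ('a \<Rightarrow> 'b) topology" where
  "compact_open_topology X Y =
     topology_generated_by
       {{f \<in> extensional (topspace X). continuous_map X Y f \<and> f ` K \<subseteq> U} | K U.
         compactin X K \<and> openin Y U}"

definition inj_map_space :: "'a set \<Rightarrow> 'b topology \<Rightarrow> ('a \<Rightarrow> 'b) topology" where
  "inj_map_space S Y =
     subtopology (compact_open_topology (discrete_topology S) Y) {\<beta>. inj_on \<beta> S}"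

text \<open>This is the opposite of the library group \<^const>\<open>BijGroup\<close>: the product of
  \<open>\<alpha>\<^sub>1\<close> and \<open>\<alpha>\<^sub>2\<close> is \<open>\<alpha>\<^sub>2 \<circ> \<alpha>\<^sub>1\<close>.\<close>

definition op_BijGroup :: "'a set \<Rightarrow> ('a \<Rightarrow> 'a) monoid" where
  "op_BijGroup S =
     \<lparr>carrier = Bij S,
      mult = \<lambda>\<alpha>\<^sub>1\<in>Bij S. \<lambda>\<alpha>\<^sub>2\<in>Bij S. compose S \<alpha>\<^sub>2 \<alpha>\<^sub>1,
      one = \<lambda>x\<in>S. x\<rparr>"

definition precomp_action :: "'a set \<Rightarrow> 'b topology \<Rightarrow> ('a \<Rightarrow> 'a) \<Rightarrow> ('a \<Rightarrow> 'b) \<Rightarrow> ('a \<Rightarrow> 'b)" where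
  "precomp_action S Y \<alpha> = (\<lambda>\<beta>\<in>topspace (inj_map_space S Y). compose S \<beta> \<alpha>)"

definition right_mult_emb :: "('a, 'r) monoid_scheme \<Rightarrow> 'a \<Rightarrow> ('a \<Rightarrow> 'a)" where
  "right_mult_emb H h = (\<lambda>h\<^sub>1\<in>carrier H. h\<^sub>1 \<otimes>\<^bsub>H\<^esub> h)"

text \<open>A free left action of a (discrete) group on a topological space, each group element
  acting by a continuous map. In \<^const>\<open>group_action\<close>, \<open>\<phi>\<close> is a homomorphism into
  \<^const>\<open>BijGroup\<close>, whose product is the usual composition, so \<open>\<phi>\<close> is a left action.\<close>

definition free_left_action ::
    "('g, 'r) monoid_scheme \<Rightarrow> 'x topology \<Rightarrow> ('g \<Rightarrow> 'x \<Rightarrow> 'x) \<Rightarrow> bool" where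
  "free_left_action G X \<phi> \<longleftrightarrow>
     group_action G (topspace X) \<phi> \<and>
     (\<forall>g\<in>carrier G. continuous_map X X (\<phi> g)) \<and>
     (\<forall>x\<in>topspace X. stabilizer G \<phi> x = {\<one>\<^bsub>G\<^esub>})"

definition orbit_map ::
    "('g, 'r) monoid_scheme \<Rightarrow> ('g \<Rightarrow> 'x \<Rightarrow> 'x) \<Rightarrow> ('x \<Rightarrow> 'y) \<Rightarrow> 'x \<Rightarrow> ('g \<Rightarrow> 'y)" where
  "orbit_map H \<phi> f x = (\<lambda>h\<in>carrier H. f (\<phi> h x))"

end

theory Submission
  imports Defs
begin

text \<open>For a discrete source the compact subsets are the finite ones, so the compact-open
  topology is the topology of pointwise convergence: a map into \<open>F\<^sub>H(Y)\<close> is continuous as soon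
  as all its evaluations are. Both continuity claims reduce to this. A value
  \<open>F\<^sub>f(x)\<close> is injective because freeness makes \<open>h \<mapsto> hx\<close> injective and \<open>f\<close> is injective
  on the orbit of \<open>x\<close>; equivariance is \<open>f(h\<^sub>1(hx)) = f((h\<^sub>1h)x)\<close>.\<close>

section \<open>The topology on spaces of injective maps\<close>

lemma topspace_compact_open_topology:
  "topspace (compact_open_topology X Y) = {f \<in> extensional (topspace X). continuous_map X Y f}"
proof (rule subset_antisym)
  show "topspace (compact_open_topology X Y) \<subseteq> {f \<in> extensional (topspace X). continuous_map X Y f}"
    by (auto simp: compact_open_topology_def)
  have "{f \<in> extensional (topspace X). continuous_map X Y f}
      = {f \<in> extensional (topspace X). continuous_map X Y f \<and> f ` {} \<subseteq> {}}"
    by simp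
  then show "{f \<in> extensional (topspace X). continuous_map X Y f} \<subseteq> topspace (compact_open_topology X Y)"
    unfolding compact_open_topology_def topology_generated_by_topspace
    by (intro Union_upper CollectI exI[of _ "{}"] conjI compactin_empty openin_empty)
qed

text \<open>On a discrete source, continuity only asks that values lie in \<open>topspace Y\<close>,
  so it is absorbed into the extensional function space.\<close>

lemma topspace_inj_map_space:
  "topspace (inj_map_space S Y) = {\<beta> \<in> S \<rightarrow>\<^sub>E topspace Y. inj_on \<beta> S}"
  by (auto simp: inj_map_space_def topspace_compact_open_topology PiE_def)

text \<open>Singletons are compact, so the preimage of an open \<open>U\<close> under evaluation at
  \<open>s\<close> is the trace of the subbasic set with \<open>K = {s}\<close>.\<close>

lemma continuous_map_inj_map_space_eval:
  assumes "s \<in> S"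
  shows "continuous_map (inj_map_space S Y) Y (\<lambda>\<beta>. \<beta> s)"
  unfolding continuous_map
proof (intro conjI allI impI)
  show "(\<lambda>\<beta>. \<beta> s) ` topspace (inj_map_space S Y) \<subseteq> topspace Y"
    using assms by (auto simp: topspace_inj_map_space)
next
  fix U assume U: "openin Y U"
  let ?B = "{\<beta> \<in> extensional S. continuous_map (discrete_topology S) Y \<beta> \<and> \<beta> ` {s} \<subseteq> U}"
  have "openin (compact_open_topology (discrete_topology S) Y) ?B"
    unfolding compact_open_topology_def
    by (rule topology_generated_by_Basis)
      (use U assms in \<open>auto simp: compactin_discrete_topology intro!: exI[of _ "{s}"] exI[of _ U]\<close>)
  moreover have "{\<beta> \<in> topspace (inj_map_space S Y). \<beta> s \<in> U} = ?B \<inter> {\<beta>. inj_on \<beta> S}"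
    by (auto simp: topspace_inj_map_space PiE_def)
  ultimately show "openin (inj_map_space S Y) {\<beta> \<in> topspace (inj_map_space S Y). \<beta> s \<in> U}"
    unfolding inj_map_space_def openin_subtopology by blast
qed

lemma continuous_map_into_inj_map_space:
  assumes g: "g \<in> topspace Z \<rightarrow> topspace (inj_map_space S Y)"
    and eval: "\<And>s. s \<in> S \<Longrightarrow> continuous_map Z Y (\<lambda>z. g z s)"
  shows "continuous_map Z (inj_map_space S Y) g"
proof -
  have g': "g z \<in> extensional S" "continuous_map (discrete_topology S) Y (g z)" "inj_on (g z) S"
    if "z \<in> topspace Z" for z
    using g that by (auto simp: topspace_inj_map_space PiE_def)
  have "continuous_map Z (compact_open_topology (discrete_topology S) Y) g"
    unfolding compact_open_topology_def
  proof (rule continuous_on_generated_topo)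
    fix B
    assume "B \<in> {{f \<in> extensional (topspace (discrete_topology S)).
        continuous_map (discrete_topology S) Y f \<and> f ` K \<subseteq> U} | K U.
        compactin (discrete_topology S) K \<and> openin Y U}"
    then obtain K U where B: "B = {f \<in> extensional S.
        continuous_map (discrete_topology S) Y f \<and> f ` K \<subseteq> U}"
      and K: "K \<subseteq> S" "finite K" and U: "openin Y U"
      by (auto simp: compactin_discrete_topology)
    \<comment> \<open>Finiteness of \<open>K\<close> makes this a finite intersection of open
      preimages. The empty \<open>K\<close> is treated apart: an intersection over it would be the
      whole type instead of \<open>topspace Z\<close>.\<close>
    have "openin Z {z \<in> topspace Z. \<forall>s\<in>K. g z s \<in> U}"
    proof (cases "K = {}")
      case False
      have "openin Z (\<Inter>s\<in>K. {z \<in> topspace Z. g z s \<in> U})"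
        using K False U by (intro openin_INT2 openin_continuous_map_preimage[OF eval]) auto
      moreover have "(\<Inter>s\<in>K. {z \<in> topspace Z. g z s \<in> U})
          = {z \<in> topspace Z. \<forall>s\<in>K. g z s \<in> U}"
        using False by auto
      ultimately show ?thesis by simp
    qed simp
    moreover have "g -` B \<inter> topspace Z = {z \<in> topspace Z. \<forall>s\<in>K. g z s \<in> U}"
      using g'(1,2) by (auto simp: B)
    ultimately show "openin Z (g -` B \<inter> topspace Z)"
      by simp
  next
    \<comment> \<open>The union of the subbasis is the underlying set of the compact-open topology,
      so it contains all values of \<open>g\<close>.\<close>
    show "g ` topspace Z \<subseteq> \<Union> {{f \<in> extensional (topspace (discrete_topology S)).
        continuous_map (discrete_topology S) Y f \<and> f ` K \<subseteq> U} | K U.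
        compactin (discrete_topology S) K \<and> openin Y U}"
      using g'(1,2) topspace_compact_open_topology[of "discrete_topology S" Y]
      unfolding compact_open_topology_def topology_generated_by_topspace by auto
  qed
  then show ?thesis
    using g'(3) by (auto simp: inj_map_space_def continuous_map_in_subtopology)
qed

section \<open>The opposite permutation group and its action by precomposition\<close>

lemma group_op_BijGroup: "group (op_BijGroup S)"
proof (rule groupI)
  fix \<alpha> assume "\<alpha> \<in> carrier (op_BijGroup S)"
  then have \<alpha>: "\<alpha> \<in> Bij S" by (simp add: op_BijGroup_def)
  \<comment> \<open>A left inverse for the reversed product is a right inverse for composition,
    which surjectivity of \<alpha> provides.\<close>
  have "compose S \<alpha> (restrict (inv_into S \<alpha>) S) = (\<lambda>x\<in>S. x)"
    using \<alpha> by (auto simp: Bij_def bij_betw_def compose_def f_inv_into_f fun_eq_iff)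
  then show "\<exists>\<beta>\<in>carrier (op_BijGroup S). \<beta> \<otimes>\<^bsub>op_BijGroup S\<^esub> \<alpha> = \<one>\<^bsub>op_BijGroup S\<^esub>"
    using \<alpha> by (auto simp: op_BijGroup_def intro!: bexI[OF _ restrict_inv_into_Bij])
qed (auto simp: op_BijGroup_def compose_Bij id_Bij Bij_imp_funcset Bij_imp_extensional
    compose_assoc compose_Id[OF Bij_imp_funcset Bij_imp_extensional])

lemma compose_Bij_in_inj_map_space:
  assumes "\<beta> \<in> topspace (inj_map_space S Y)" "\<alpha> \<in> Bij S"
  shows "compose S \<beta> \<alpha> \<in> topspace (inj_map_space S Y)"
proof -
  have "inj_on (\<beta> \<circ> \<alpha>) S"
    using assms by (intro comp_inj_on) (auto simp: topspace_inj_map_space Bij_def bij_betw_def)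
  then have "inj_on (compose S \<beta> \<alpha>) S"
    by (simp add: compose_def inj_on_def)
  then show ?thesis
    using assms Bij_imp_funcset[OF assms(2)] by (auto simp: topspace_inj_map_space compose_def)
qed

text \<open>Precomposition reverses the usual order of composition; the reversed product undoes
  this, which is why a left action results.\<close>

lemma compose_op_mult:
  assumes "\<alpha> \<in> Bij S" "\<alpha>' \<in> Bij S"
  shows "compose S \<beta> (\<alpha> \<otimes>\<^bsub>op_BijGroup S\<^esub> \<alpha>') = compose S (compose S \<beta> \<alpha>') \<alpha>"
  using assms Bij_imp_funcset[OF assms(1)]
  by (auto simp: op_BijGroup_def compose_def fun_eq_iff)

text \<open>Precomposition with the inverse permutation is a two-sided inverse. Elements of the
  space are extensional, so cancelling returns \<beta> itself and not merely a function agreeing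
  with it on \<open>S\<close>.\<close>

lemma precomp_action_Bij:
  assumes "\<alpha> \<in> Bij S"
  shows "precomp_action S Y \<alpha> \<in> Bij (topspace (inj_map_space S Y))"
proof -
  let ?E = "topspace (inj_map_space S Y)"
  let ?\<alpha>' = "restrict (inv_into S \<alpha>) S"
  have \<alpha>': "?\<alpha>' \<in> Bij S"
    by (rule restrict_inv_into_Bij[OF assms])
  have "compose S (compose S \<beta> \<alpha>) ?\<alpha>' = \<beta>" "compose S (compose S \<beta> ?\<alpha>') \<alpha> = \<beta>"
    if "\<beta> \<in> ?E" for \<beta>
    using that assms
    by (auto simp: topspace_inj_map_space Bij_def bij_betw_def compose_def fun_eq_iff
        f_inv_into_f inv_into_into PiE_def extensional_def)
  then have "bij_betw (precomp_action S Y \<alpha>) ?E ?E"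
    by (intro bij_betw_byWitness[where f' = "\<lambda>\<beta>. compose S \<beta> ?\<alpha>'"])
      (auto simp: precomp_action_def compose_Bij_in_inj_map_space assms \<alpha>')
  then show ?thesis
    by (simp add: Bij_def precomp_action_def)
qed

lemma free_left_action_precomp:
  "free_left_action (op_BijGroup S) (inj_map_space S Y) (precomp_action S Y)"
  unfolding free_left_action_def
proof (intro conjI ballI)
  let ?E = "topspace (inj_map_space S Y)"
  have "precomp_action S Y \<in> hom (op_BijGroup S) (BijGroup ?E)"
  proof (rule homI)
    fix \<alpha> assume "\<alpha> \<in> carrier (op_BijGroup S)"
    then show "precomp_action S Y \<alpha> \<in> carrier (BijGroup ?E)"
      by (simp add: op_BijGroup_def BijGroup_def precomp_action_Bij)
  next
    fix \<alpha> \<alpha>' assume "\<alpha> \<in> carrier (op_BijGroup S)" "\<alpha>' \<in> carrier (op_BijGroup S)"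
    then have \<alpha>: "\<alpha> \<in> Bij S" "\<alpha>' \<in> Bij S"
      by (simp_all add: op_BijGroup_def)
    show "precomp_action S Y (\<alpha> \<otimes>\<^bsub>op_BijGroup S\<^esub> \<alpha>')
        = precomp_action S Y \<alpha> \<otimes>\<^bsub>BijGroup ?E\<^esub> precomp_action S Y \<alpha>'"
    proof -
      have "precomp_action S Y (\<alpha> \<otimes>\<^bsub>op_BijGroup S\<^esub> \<alpha>')
          = compose ?E (precomp_action S Y \<alpha>) (precomp_action S Y \<alpha>')"
        using \<alpha> by (auto simp: precomp_action_def compose_op_mult compose_Bij_in_inj_map_space
            compose_def[of ?E])
      then show ?thesis
        using \<alpha> by (simp add: BijGroup_def precomp_action_Bij)
    qed
  qed
  then show "group_action (op_BijGroup S) ?E (precomp_action S Y)"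
    by (simp add: group_action_def group_hom_def group_hom_axioms_def group_op_BijGroup
        group_BijGroup)
next
  fix \<alpha> assume "\<alpha> \<in> carrier (op_BijGroup S)"
  then have \<alpha>: "\<alpha> \<in> Bij S"
    by (simp add: op_BijGroup_def)
  \<comment> \<open>Following this map by evaluation at \<open>s\<close> gives evaluation at
    \<open>\<alpha> s\<close>, which is already known to be continuous.\<close>
  have "continuous_map (inj_map_space S Y) (inj_map_space S Y) (\<lambda>\<beta>. compose S \<beta> \<alpha>)"
  proof (rule continuous_map_into_inj_map_space)
    fix s assume "s \<in> S"
    then show "continuous_map (inj_map_space S Y) Y (\<lambda>\<beta>. compose S \<beta> \<alpha> s)"
      using Bij_imp_funcset[OF \<alpha>]
      by (auto simp: compose_def intro!: continuous_map_inj_map_space_eval)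
  qed (simp add: compose_Bij_in_inj_map_space \<alpha>)
  then show "continuous_map (inj_map_space S Y) (inj_map_space S Y) (precomp_action S Y \<alpha>)"
    by (rule continuous_map_eq) (simp add: precomp_action_def)
next
  fix \<beta> assume \<beta>: "\<beta> \<in> topspace (inj_map_space S Y)"
  \<comment> \<open>Freeness: the injective \<beta> can be cancelled on the left.\<close>
  have "\<alpha> = (\<lambda>x\<in>S. x)" if \<alpha>: "\<alpha> \<in> Bij S" and eq: "compose S \<beta> \<alpha> = \<beta>" for \<alpha>
  proof (rule extensionalityI)
    fix x assume x: "x \<in> S"
    then have "\<beta> (\<alpha> x) = \<beta> x"
      using eq by (metis compose_eq)
    then show "\<alpha> x = (\<lambda>x\<in>S. x) x"
      using \<beta> x Bij_imp_funcset[OF \<alpha>] by (auto simp: topspace_inj_map_space inj_on_def)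
  qed (use \<alpha> Bij_imp_extensional in auto)
  moreover have "compose S \<beta> (\<lambda>x\<in>S. x) = \<beta>"
    using \<beta> by (auto simp: topspace_inj_map_space compose_def fun_eq_iff PiE_def extensional_def)
  ultimately show "stabilizer (op_BijGroup S) (precomp_action S Y) \<beta> = {\<one>\<^bsub>op_BijGroup S\<^esub>}"
    using \<beta> by (auto simp: stabilizer_def op_BijGroup_def precomp_action_def id_Bij)
qed

section \<open>The embedding by right multiplication\<close>

context group
begin

text \<open>Right multiplication by \<open>inv h\<close> is the inverse.\<close>

lemma right_mult_emb_Bij:
  assumes "h \<in> carrier G"
  shows "right_mult_emb G h \<in> Bij (carrier G)"
proof -
  have "bij_betw (\<lambda>x. x \<otimes> h) (carrier G) (carrier G)"
    using assms by (intro bij_betw_byWitness[where f' = "\<lambda>x. x \<otimes> inv h"]) (auto simp: m_assoc)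
  then show ?thesis
    by (simp add: Bij_def right_mult_emb_def)
qed

text \<open>By associativity, multiplying on the right by \<open>h \<otimes> k\<close> means
  multiplying first by \<open>h\<close>, then by \<open>k\<close>: exactly the order of the reversed
  product. Evaluation at \<one> recovers \<open>h\<close>, hence injectivity.\<close>

lemma right_mult_emb_mon: "right_mult_emb G \<in> mon G (op_BijGroup (carrier G))"
proof -
  have "right_mult_emb G \<in> hom G (op_BijGroup (carrier G))"
  proof (rule homI)
    fix h k assume hk: "h \<in> carrier G" "k \<in> carrier G"
    then have "right_mult_emb G (h \<otimes> k)
        = compose (carrier G) (right_mult_emb G k) (right_mult_emb G h)"
      by (auto simp: right_mult_emb_def compose_def fun_eq_iff m_assoc)
    then show "right_mult_emb G (h \<otimes> k)
        = right_mult_emb G h \<otimes>\<^bsub>op_BijGroup (carrier G)\<^esub> right_mult_emb G k"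
      using hk by (simp add: op_BijGroup_def right_mult_emb_Bij)
  qed (simp add: op_BijGroup_def right_mult_emb_Bij)
  moreover have "inj_on (right_mult_emb G) (carrier G)"
  proof (rule inj_onI)
    fix h k assume "h \<in> carrier G" "k \<in> carrier G" "right_mult_emb G h = right_mult_emb G k"
    then show "h = k"
      by (auto simp: right_mult_emb_def dest!: fun_cong[of _ _ \<one>])
  qed
  ultimately show ?thesis
    by (simp add: mon_def)
qed

end

section \<open>Maps out of a free action\<close>

lemma free_left_action_inj:
  fixes G (structure)
  assumes "free_left_action G X \<phi>" and x: "x \<in> topspace X"
  shows "inj_on (\<lambda>g. \<phi> g x) (carrier G)"
proof (rule inj_onI)
  interpret group_action G "topspace X" \<phi>
    using assms(1) by (simp add: free_left_action_def)
  interpret group G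
    using group_hom by (rule group_hom.axioms(1))
  fix g h assume gh: "g \<in> carrier G" "h \<in> carrier G" and eq: "\<phi> g x = \<phi> h x"
  \<comment> \<open>Applying \<open>inv h\<close> to the common point
    \<open>\<phi> g x = \<phi> h x\<close> puts \<open>inv h \<otimes> g\<close> into the trivial
    stabilizer of \<open>x\<close>.\<close>
  have "\<phi> (inv h \<otimes> g) x = x"
    using gh x eq orbit_sym_aux[OF gh(2) x refl] by (simp add: composition_rule)
  then have "inv h \<otimes> g \<in> stabilizer G \<phi> x"
    using gh by (simp add: stabilizer_def)
  then have "inv h \<otimes> g = \<one>"
    using assms by (simp add: free_left_action_def)
  then show "g = h"
    using gh by (metis inv_closed inv_equality inv_inv)
qed

theorem lemma2p2:
  fixes H :: "('g, 'r) monoid_scheme"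
    and X :: "'x topology"
    and Y :: "'y topology"
    and \<phi> :: "'g \<Rightarrow> 'x \<Rightarrow> 'x"
    and f :: "'x \<Rightarrow> 'y"
  assumes "group H"
    and "finite (carrier H)"
    and "free_left_action H X \<phi>"
    and "continuous_map X Y f"
    and "\<forall>B\<in>orbits H (topspace X) \<phi>. inj_on f B"
  shows "right_mult_emb H \<in> mon H (op_BijGroup (carrier H))
    \<and> free_left_action (op_BijGroup (carrier H)) (inj_map_space (carrier H) Y)
        (precomp_action (carrier H) Y)
    \<and> continuous_map X (inj_map_space (carrier H) Y) (orbit_map H \<phi> f)
    \<and> (\<forall>h\<in>carrier H. \<forall>x\<in>topspace X.
         orbit_map H \<phi> f (\<phi> h x)
           = precomp_action (carrier H) Y (right_mult_emb H h) (orbit_map H \<phi> f x))"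
proof (intro conjI ballI)
  interpret group H by fact
  interpret group_action H "topspace X" \<phi>
    using assms(3) by (simp add: free_left_action_def)
  show "right_mult_emb H \<in> mon H (op_BijGroup (carrier H))"
    by (rule right_mult_emb_mon)
  show "free_left_action (op_BijGroup (carrier H)) (inj_map_space (carrier H) Y)
      (precomp_action (carrier H) Y)"
    by (rule free_left_action_precomp)
  \<comment> \<open>This serves twice: as the codomain condition for continuity, and to unfold
    \<open>precomp_action\<close>, whose values are specified only on injective maps.\<close>
  have orbit_map_in: "orbit_map H \<phi> f x \<in> topspace (inj_map_space (carrier H) Y)"
    if x: "x \<in> topspace X" for x
  proof -
    have "(\<lambda>h. \<phi> h x) ` carrier H \<in> orbits H (topspace X) \<phi>"
      using x by (auto simp: orbits_def orbit_def)
    then have "inj_on f ((\<lambda>h. \<phi> h x) ` carrier H)"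
      using assms(5) by blast
    then have "inj_on (\<lambda>h. f (\<phi> h x)) (carrier H)"
      using comp_inj_on[OF free_left_action_inj[OF assms(3) x]] by (simp add: comp_def)
    then have "inj_on (orbit_map H \<phi> f x) (carrier H)"
      by (simp add: orbit_map_def inj_on_def)
    moreover have "f (\<phi> h x) \<in> topspace Y" if "h \<in> carrier H" for h
      using that x assms(4) element_image by (metis continuous_map_def Pi_iff)
    ultimately show ?thesis
      by (auto simp: topspace_inj_map_space orbit_map_def)
  qed
  show "continuous_map X (inj_map_space (carrier H) Y) (orbit_map H \<phi> f)"
  \<comment> \<open>Evaluation at \<open>h\<close> turns the orbit map into \<open>f\<close> after
    \<open>\<phi> h\<close>, a composite of continuous maps.\<close>
  proof (rule continuous_map_into_inj_map_space)
    fix h assume h: "h \<in> carrier H"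
    then have "continuous_map X X (\<phi> h)"
      using assms(3) by (simp add: free_left_action_def)
    then show "continuous_map X Y (\<lambda>x. orbit_map H \<phi> f x h)"
      using continuous_map_compose[OF _ assms(4)] h by (simp add: orbit_map_def comp_def)
  qed (use orbit_map_in in blast)
  fix h x assume hx: "h \<in> carrier H" "x \<in> topspace X"
  \<comment> \<open>The two functions agree at each point of the group by the action law; outside it
    both are undefined by restriction.\<close>
  have "orbit_map H \<phi> f (\<phi> h x)
      = compose (carrier H) (orbit_map H \<phi> f x) (right_mult_emb H h)"
    using hx by (auto simp: orbit_map_def compose_def right_mult_emb_def composition_rule)
  then show "orbit_map H \<phi> f (\<phi> h x)
      = precomp_action (carrier H) Y (right_mult_emb H h) (orbit_map H \<phi> f x)"
    using hx by (simp add: precomp_action_def orbit_map_in)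
qed

end
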